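(* Let $N$ be a von Neumann algebra, let $P:N\to N$ be a normal unital completely positive map, and let $H^\infty(N,P)=\{x\in N;\ P(x)=x\}$. For any $a,b\in H^\infty(N,P)$, the sequence $\{P^n(ab)\}_{n=1}^\infty$ converges to the Choi-Effros product $a\circ b$ in the strong operator topology.
   Context: Choi-Effros product: $H^\infty(N,P)$ is a weakly closed operator system in $N$ (a self-adjoint linear subspace containing the identity), and it is the image of a completely positive projection $E$ from $N$, e.g. $E(x)=\mathrm{w}\text{-}\lim_{n\to\omega}\frac1n\sum_{k=0}^{n-1}P^k(x)$ for a free ultrafilter $\omega$ on $\mathbb{N}$. It is a von Neumann algebra with respect to the Choi-Effros product $x\circ y=E(xy)$, and this product does not depend on the choice of $\omega$ (an operator system carries at most one von Neumann algebra structure). In $P^n(ab)$ the product $ab$ is the product in $N$. *)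

theory Defs
  imports "HOL-Analysis.Analysis"
begin

section \<open>Complex Hilbert spaces\<close>

text \<open>The real Hilbert space structure (norm, topology, completeness) is inherited from the
  library classes; the complex inner product is linear in its first argument, and its real part is
  the library's real inner product.\<close>

class complex_hilbert_space = real_inner + complete_space +
  fixes scaleC :: "complex \<Rightarrow> 'a \<Rightarrow> 'a" (infixr \<open>*\<^sub>C\<close> 75)
    and cinner :: "'a \<Rightarrow> 'a \<Rightarrow> complex"
  assumes scaleC_add_right: "c *\<^sub>C (x + y) = c *\<^sub>C x + c *\<^sub>C y"
    and scaleC_add_left: "(c + d) *\<^sub>C x = c *\<^sub>C x + d *\<^sub>C x"
    and scaleC_scaleC: "c *\<^sub>C d *\<^sub>C x = (c * d) *\<^sub>C x"
    and scaleC_of_real: "complex_of_real r *\<^sub>C x = r *\<^sub>R x"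
    and cinner_commute: "cinner x y = cnj (cinner y x)"
    and cinner_add_left: "cinner (x + y) z = cinner x z + cinner y z"
    and cinner_scaleC_left: "cinner (c *\<^sub>C x) y = c * cinner x y"
    and Re_cinner: "Re (cinner x y) = inner x y"

instantiation complex :: complex_hilbert_space
begin

definition scaleC_complex :: "complex \<Rightarrow> complex \<Rightarrow> complex" where
  "scaleC_complex c x = c * x"

definition cinner_complex :: "complex \<Rightarrow> complex \<Rightarrow> complex" where
  "cinner_complex x y = x * cnj y"

instance
  by standard
    (auto simp: scaleC_complex_def cinner_complex_def inner_complex_def algebra_simps
      scaleR_conv_of_real)

end

lemma norm_scaleC: "norm (c *\<^sub>C x) = cmod c * norm (x :: 'h::complex_hilbert_space)"
proof -
  have "cinner (c *\<^sub>C x) (c *\<^sub>C x) = c * cnj (c * cinner x x)"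
    by (metis cinner_scaleC_left cinner_commute)
  also have "\<dots> = c * cnj c * cinner x x"
    by (metis cinner_commute complex_cnj_mult mult.assoc)
  also have "\<dots> = complex_of_real ((cmod c)\<^sup>2) * cinner x x"
    by (simp only: complex_norm_square)
  finally have "Re (cinner (c *\<^sub>C x) (c *\<^sub>C x)) = (cmod c)\<^sup>2 * Re (cinner x x)"
    by (simp only: Re_complex_of_real times_complex.sel Im_complex_of_real)
  then have "(norm (c *\<^sub>C x))\<^sup>2 = (cmod c * norm x)\<^sup>2"
    by (simp add: Re_cinner power2_norm_eq_inner power_mult_distrib)
  then show ?thesis
    by (simp add: power2_eq_iff_nonneg)
qed

section \<open>Operators on a complex Hilbert space\<close>

text \<open>The type \<open>'h \<Rightarrow>\<^sub>L 'h\<close> consists of the bounded \<^emph>\<open>real\<close>-linear operators;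
  \<open>B(H)\<close> is the set \<open>bounded_clinear_ops\<close>.\<close>

definition bounded_clinear_ops :: "('h::complex_hilbert_space \<Rightarrow>\<^sub>L 'h) set" where
  "bounded_clinear_ops =
     {A. \<forall>c x. blinfun_apply A (c *\<^sub>C x) = c *\<^sub>C blinfun_apply A x}"

lift_definition scaleC_op ::
    "complex \<Rightarrow> ('h::complex_hilbert_space \<Rightarrow>\<^sub>L 'h) \<Rightarrow> ('h \<Rightarrow>\<^sub>L 'h)"
  is "\<lambda>c A x. c *\<^sub>C A x"
proof -
  fix c :: complex and A :: "'h \<Rightarrow> 'h"
  assume A: "bounded_linear A"
  have "bounded_linear (\<lambda>x::'h. c *\<^sub>C x)"
  proof (rule bounded_linear_intro[where K = "cmod c"])
    show "c *\<^sub>C (r *\<^sub>R x) = r *\<^sub>R (c *\<^sub>C x)" for r and x :: 'h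
      by (metis scaleC_of_real scaleC_scaleC mult.commute)
  qed (simp_all add: scaleC_add_right norm_scaleC mult.commute)
  then show "bounded_linear (\<lambda>x. c *\<^sub>C A x)"
    using A by (rule bounded_linear_compose)
qed

definition is_adjoint ::
    "('h::complex_hilbert_space \<Rightarrow>\<^sub>L 'h) \<Rightarrow> ('h \<Rightarrow>\<^sub>L 'h) \<Rightarrow> bool" where
  "is_adjoint A B \<longleftrightarrow>
     (\<forall>x y. cinner (blinfun_apply A x) y = cinner x (blinfun_apply B y))"

text \<open>Initial topology for the functionals \<open>A \<mapsto> \<langle>A x, y\<rangle>\<close>. The strong operator topology is
  the library's \<open>strong_operator_topology\<close>.\<close>

definition weak_operator_topology :: "('h::complex_hilbert_space \<Rightarrow>\<^sub>L 'h) topology" where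
  "weak_operator_topology =
     pullback_topology UNIV (\<lambda>A (x, y). cinner (blinfun_apply A x) y) euclidean"

definition square_summable_pairs ::
    "((nat \<Rightarrow> 'h::complex_hilbert_space) \<times> (nat \<Rightarrow> 'h)) set" where
  "square_summable_pairs =
     {(\<xi>, \<eta>). summable (\<lambda>k. (norm (\<xi> k))\<^sup>2) \<and> summable (\<lambda>k. (norm (\<eta> k))\<^sup>2)}"

text \<open>The \<open>\<sigma>\<close>-weak topology: the initial topology for the functionals
  \<open>A \<mapsto> \<Sum>k. \<langle>A \<xi>\<^sub>k, \<eta>\<^sub>k\<rangle>\<close> with \<open>\<xi>\<close>, \<open>\<eta>\<close> square-summable.\<close>

definition ultraweak_topology :: "('h::complex_hilbert_space \<Rightarrow>\<^sub>L 'h) topology" where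
  "ultraweak_topology =
     pullback_topology UNIV
       (\<lambda>A. \<lambda>(\<xi>, \<eta>)\<in>square_summable_pairs. \<Sum>k. cinner (blinfun_apply A (\<xi> k)) (\<eta> k))
       (product_topology (\<lambda>_. euclidean) square_summable_pairs)"

definition von_neumann_algebra :: "('h::complex_hilbert_space \<Rightarrow>\<^sub>L 'h) set \<Rightarrow> bool" where
  "von_neumann_algebra N \<longleftrightarrow>
     N \<subseteq> bounded_clinear_ops \<and>
     id_blinfun \<in> N \<and>
     (\<forall>A\<in>N. \<forall>B\<in>N. A + B \<in> N) \<and>
     (\<forall>c. \<forall>A\<in>N. scaleC_op c A \<in> N) \<and>
     (\<forall>A\<in>N. \<forall>B\<in>N. A o\<^sub>L B \<in> N) \<and>
     (\<forall>A\<in>N. \<exists>B\<in>N. is_adjoint A B) \<and>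
     closedin weak_operator_topology N"

section \<open>Normal unital completely positive maps\<close>

text \<open>Maps on \<open>N\<close> are represented by functions on all operators; only their values on \<open>N\<close>
  are constrained or used.\<close>

definition clinear_map_on ::
    "('h::complex_hilbert_space \<Rightarrow>\<^sub>L 'h) set \<Rightarrow> (('h \<Rightarrow>\<^sub>L 'h) \<Rightarrow> ('h \<Rightarrow>\<^sub>L 'h)) \<Rightarrow> bool" where
  "clinear_map_on N P \<longleftrightarrow>
     P ` N \<subseteq> N \<and>
     (\<forall>A\<in>N. \<forall>B\<in>N. P (A + B) = P A + P B) \<and>
     (\<forall>c. \<forall>A\<in>N. P (scaleC_op c A) = scaleC_op c (P A))"

text \<open>Positivity of an \<open>n \<times> n\<close> operator matrix \<open>(A i j)\<close>, \<open>i, j < n\<close>, as an operator on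
  \<open>H\<^sup>n\<close>.\<close>

definition positive_matrix ::
    "nat \<Rightarrow> (nat \<Rightarrow> nat \<Rightarrow> ('h::complex_hilbert_space \<Rightarrow>\<^sub>L 'h)) \<Rightarrow> bool" where
  "positive_matrix n A \<longleftrightarrow>
     (\<forall>\<xi>. (\<Sum>i<n. \<Sum>j<n. cinner (blinfun_apply (A i j) (\<xi> j)) (\<xi> i)) \<in> \<real>\<^sub>\<ge>\<^sub>0)"

definition completely_positive_on ::
    "('h::complex_hilbert_space \<Rightarrow>\<^sub>L 'h) set \<Rightarrow> (('h \<Rightarrow>\<^sub>L 'h) \<Rightarrow> ('h \<Rightarrow>\<^sub>L 'h)) \<Rightarrow> bool" where
  "completely_positive_on N P \<longleftrightarrow>
     clinear_map_on N P \<and>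
     (\<forall>n A. (\<forall>i<n. \<forall>j<n. A i j \<in> N) \<and> positive_matrix n A
        \<longrightarrow> positive_matrix n (\<lambda>i j. P (A i j)))"

definition normal_on ::
    "('h::complex_hilbert_space \<Rightarrow>\<^sub>L 'h) set \<Rightarrow> (('h \<Rightarrow>\<^sub>L 'h) \<Rightarrow> ('h \<Rightarrow>\<^sub>L 'h)) \<Rightarrow> bool" where
  "normal_on N P \<longleftrightarrow>
     continuous_map (subtopology ultraweak_topology N) (subtopology ultraweak_topology N) P"

definition normal_ucp ::
    "('h::complex_hilbert_space \<Rightarrow>\<^sub>L 'h) set \<Rightarrow> (('h \<Rightarrow>\<^sub>L 'h) \<Rightarrow> ('h \<Rightarrow>\<^sub>L 'h)) \<Rightarrow> bool" where
  "normal_ucp N P \<longleftrightarrow>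
     normal_on N P \<and> P id_blinfun = id_blinfun \<and> completely_positive_on N P"

section \<open>The Choi--Effros product\<close>

definition H_infinity ::
    "('h::complex_hilbert_space \<Rightarrow>\<^sub>L 'h) set \<Rightarrow> (('h \<Rightarrow>\<^sub>L 'h) \<Rightarrow> ('h \<Rightarrow>\<^sub>L 'h))
      \<Rightarrow> ('h \<Rightarrow>\<^sub>L 'h) set" where
  "H_infinity N P = {x \<in> N. P x = x}"

definition cp_projection_onto ::
    "('h::complex_hilbert_space \<Rightarrow>\<^sub>L 'h) set \<Rightarrow> ('h \<Rightarrow>\<^sub>L 'h) set
      \<Rightarrow> (('h \<Rightarrow>\<^sub>L 'h) \<Rightarrow> ('h \<Rightarrow>\<^sub>L 'h)) \<Rightarrow> bool" where
  "cp_projection_onto N S E \<longleftrightarrow>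
     completely_positive_on N E \<and> (\<forall>x\<in>N. E (E x) = E x) \<and> E ` N = S"

definition free_ultrafilter :: "nat filter \<Rightarrow> bool" where
  "free_ultrafilter \<omega> \<longleftrightarrow>
     \<omega> \<noteq> bot \<and>
     (\<forall>Q. eventually Q \<omega> \<or> eventually (\<lambda>n. \<not> Q n) \<omega>) \<and>
     (\<forall>m. eventually (\<lambda>n. n \<noteq> m) \<omega>)"

text \<open>\<open>E(x) = w-lim\<^bsub>n\<rightarrow>\<omega>\<^esub> (1/n) \<Sum>\<^bsub>k<n\<^esub> P\<^sup>k(x)\<close>\<close>

definition cesaro_projection ::
    "nat filter \<Rightarrow> (('h::complex_hilbert_space \<Rightarrow>\<^sub>L 'h) \<Rightarrow> ('h \<Rightarrow>\<^sub>L 'h))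
      \<Rightarrow> ('h \<Rightarrow>\<^sub>L 'h) \<Rightarrow> ('h \<Rightarrow>\<^sub>L 'h)" where
  "cesaro_projection \<omega> P x =
     (THE y. limitin weak_operator_topology
        (\<lambda>n. (1 / real n) *\<^sub>R (\<Sum>k<n. (P ^^ k) x)) y \<omega>)"

definition choi_effros_product ::
    "(('h::complex_hilbert_space \<Rightarrow>\<^sub>L 'h) \<Rightarrow> ('h \<Rightarrow>\<^sub>L 'h))
      \<Rightarrow> ('h \<Rightarrow>\<^sub>L 'h) \<Rightarrow> ('h \<Rightarrow>\<^sub>L 'h) \<Rightarrow> ('h \<Rightarrow>\<^sub>L 'h)" where
  "choi_effros_product E x y = E (x o\<^sub>L y)"

end

theory Submission
  imports Defs
begin

text \<open>For \<open>x\<close> fixed by \<open>P\<close>, the Kadison--Schwarz inequality gives \<open>P(x\<^sup>* x) \<ge> x\<^sup>* x\<close>, so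
  \<open>P\<^sup>n(x\<^sup>* x)\<close> is increasing and bounded and hence converges strongly; by normality its limit \<open>q\<close>
  is fixed by \<open>P\<close>. Any completely positive projection \<open>E\<close> onto the fixed points sends \<open>x\<^sup>* x\<close> to
  \<open>q\<close>, since \<open>q\<close> is the least fixed point above \<open>x\<^sup>* x\<close>. Polarization passes from \<open>x\<^sup>* x\<close> to \<open>a b\<close>, and
  Cesaro means along a free ultrafilter have the same limit as the sequence itself.\<close>

section \<open>Complex inner products\<close>

lemma scaleC_minus_one: "(-1) *\<^sub>C (x :: 'h::complex_hilbert_space) = - x"
  using scaleC_of_real[of "-1" x] by simp

lemma scaleC_i_i: "\<i> *\<^sub>C \<i> *\<^sub>C (x :: 'h::complex_hilbert_space) = - x"
  by (simp add: scaleC_scaleC scaleC_minus_one)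

lemma cinner_zero_left [simp]: "cinner 0 (y :: 'h::complex_hilbert_space) = 0"
  using cinner_add_left[of "0 :: 'h" 0 y] by simp

lemma cinner_zero_right [simp]: "cinner (x :: 'h::complex_hilbert_space) 0 = 0"
  by (metis cinner_commute cinner_zero_left complex_cnj_zero)

lemma cinner_add_right:
  "cinner (x :: 'h::complex_hilbert_space) (y + z) = cinner x y + cinner x z"
  by (metis cinner_add_left cinner_commute complex_cnj_add)

lemma cinner_scaleC_right:
  "cinner (x :: 'h::complex_hilbert_space) (c *\<^sub>C y) = cnj c * cinner x y"
  by (metis cinner_commute cinner_scaleC_left complex_cnj_mult)

lemma cinner_minus_left: "cinner (- x :: 'h::complex_hilbert_space) y = - cinner x y"
  by (metis cinner_scaleC_left mult_minus1 scaleC_minus_one)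

lemma cinner_minus_right: "cinner (x :: 'h::complex_hilbert_space) (- y) = - cinner x y"
  by (metis cinner_commute cinner_minus_left complex_cnj_minus)

lemma cinner_diff_left:
  "cinner (x - y :: 'h::complex_hilbert_space) z = cinner x z - cinner y z"
  using cinner_add_left[of x "- y" z] by (simp add: cinner_minus_left)

lemma Im_cinner: "Im (cinner x y) = inner x (\<i> *\<^sub>C (y :: 'h::complex_hilbert_space))"
  by (simp flip: Re_cinner add: cinner_scaleC_right)

text \<open>Reduces the complex inner product to two real ones, so that its continuity is inherited
  from that of \<open>inner\<close>.\<close>

lemma cinner_eq_Complex:
  "cinner x y = Complex (inner x y) (inner x (\<i> *\<^sub>C (y :: 'h::complex_hilbert_space)))"
  by (simp add: complex_eq_iff Re_cinner Im_cinner)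

lemma cinner_self: "cinner x x = complex_of_real ((norm (x :: 'h::complex_hilbert_space))\<^sup>2)"
proof -
  have "Im (cinner x x) = 0"
    using cinner_commute[of x x] by (simp add: complex_eq_iff)
  then show ?thesis
    by (simp add: complex_eq_iff Re_cinner power2_norm_eq_inner)
qed

lemma cinner_eqI:
  assumes "\<And>y. cinner x y = cinner x' (y :: 'h::complex_hilbert_space)"
  shows "x = x'"
  using assms[of "x - x'"] cinner_self[of "x - x'"] by (simp add: cinner_diff_left)

text \<open>The factor 2 comes from bounding the real and imaginary parts separately by the real
  Cauchy-Schwarz inequality. A crude constant suffices, since the bound only serves to dominate a
  series.\<close>

lemma norm_cinner_le: "cmod (cinner x y) \<le> 2 * (norm x * norm (y :: 'h::complex_hilbert_space))"
proof -
  have "\<bar>inner x y\<bar> \<le> norm x * norm y" "\<bar>inner x (\<i> *\<^sub>C y)\<bar> \<le> norm x * norm y"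
    using Cauchy_Schwarz_ineq2[of x y] Cauchy_Schwarz_ineq2[of x "\<i> *\<^sub>C y"]
    by (simp_all add: norm_scaleC)
  then show ?thesis
    using cmod_le[of "cinner x y"] by (simp add: Re_cinner Im_cinner)
qed

lemma tendsto_cinner_left:
  fixes y :: "'h::complex_hilbert_space"
  assumes "(f \<longlongrightarrow> l) F"
  shows "((\<lambda>n. cinner (f n) y) \<longlongrightarrow> cinner l y) F"
  unfolding cinner_eq_Complex by (intro tendsto_Complex tendsto_inner assms tendsto_const)

lemma tendsto_scaleC:
  fixes l :: "'h::complex_hilbert_space"
  assumes "(f \<longlongrightarrow> l) F"
  shows "((\<lambda>n. c *\<^sub>C f n) \<longlongrightarrow> c *\<^sub>C l) F"
  using bounded_linear.tendsto[OF blinfun.bounded_linear_right[of "scaleC_op c id_blinfun"] assms]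
  by (simp add: scaleC_op.rep_eq)

lemma is_adjoint_unique:
  assumes "is_adjoint A B" "is_adjoint A C"
  shows "B = C"
proof (rule blinfun_eqI, rule cinner_eqI)
  fix x y
  show "cinner (blinfun_apply B x) y = cinner (blinfun_apply C x) y"
    using assms unfolding is_adjoint_def by (metis cinner_commute)
qed

lemma is_adjoint_sym: "is_adjoint A B \<Longrightarrow> is_adjoint B A"
  unfolding is_adjoint_def by (metis cinner_commute)

section \<open>Convergence in the operator topologies\<close>

text \<open>The open sets of a pullback topology are exactly the preimages of open sets. This turns
  convergence in each operator topology into convergence of its defining functionals.\<close>

lemma limitin_pullback_topology:
  "limitin (pullback_topology UNIV f T) g l F \<longleftrightarrow> limitin T (\<lambda>n. f (g n)) (f l) F"
  by (auto simp: limitin_def openin_pullback_topology topspace_pullback_topology)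

lemma limitin_euclidean_fun:
  "limitin euclidean f l F \<longleftrightarrow> (\<forall>i. ((\<lambda>n. f n i) \<longlongrightarrow> (l i :: 'a::topological_space)) F)"
  by (simp add: limitin_componentwise flip: euclidean_product_topology)

lemma limitin_strong_operator_topology:
  "limitin strong_operator_topology T Q F \<longleftrightarrow>
     (\<forall>x. ((\<lambda>n. blinfun_apply (T n) x) \<longlongrightarrow> blinfun_apply Q x) F)"
  unfolding strong_operator_topology_def limitin_pullback_topology limitin_euclidean_fun ..

lemma limitin_weak_operator_topology:
  "limitin weak_operator_topology T Q F \<longleftrightarrow>
     (\<forall>x y. ((\<lambda>n. cinner (blinfun_apply (T n) x) y) \<longlongrightarrow> cinner (blinfun_apply Q x) y) F)"
  unfolding weak_operator_topology_def limitin_pullback_topology limitin_euclidean_fun by simp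

lemma limitin_ultraweak_topology:
  "limitin ultraweak_topology T Q F \<longleftrightarrow>
     (\<forall>(\<xi>, \<eta>) \<in> square_summable_pairs.
        ((\<lambda>n. \<Sum>k. cinner (blinfun_apply (T n) (\<xi> k)) (\<eta> k))
           \<longlongrightarrow> (\<Sum>k. cinner (blinfun_apply Q (\<xi> k)) (\<eta> k))) F)"
  unfolding ultraweak_topology_def limitin_pullback_topology limitin_componentwise
  by (auto simp: case_prod_beta)

lemma limitin_weak_operator_topology_unique:
  assumes "limitin weak_operator_topology T Q F" "limitin weak_operator_topology T R F" "F \<noteq> bot"
  shows "Q = R"
proof (rule blinfun_eqI, rule cinner_eqI)
  fix x y
  show "cinner (blinfun_apply Q x) y = cinner (blinfun_apply R x) y"
    using assms unfolding limitin_weak_operator_topology by (blast intro: tendsto_unique)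
qed

lemma strong_imp_weak_limit:
  assumes "limitin strong_operator_topology T Q F"
  shows "limitin weak_operator_topology T Q F"
  using assms
  by (auto simp: limitin_strong_operator_topology limitin_weak_operator_topology
      intro: tendsto_cinner_left)

lemma ultraweak_imp_weak_limit:
  fixes T :: "'b \<Rightarrow> ('h::complex_hilbert_space \<Rightarrow>\<^sub>L 'h)"
  assumes "limitin ultraweak_topology T Q F"
  shows "limitin weak_operator_topology T Q F"
  unfolding limitin_weak_operator_topology
proof (intro allI)
  fix x y :: 'h
  \<comment> \<open>Sequences concentrated at index 0 reduce the ultraweak functional to the single
    coefficient given by \<open>x\<close> and \<open>y\<close>.\<close>
  define \<delta> :: "'h \<Rightarrow> nat \<Rightarrow> 'h" where "\<delta> = (\<lambda>z k. if k = 0 then z else 0)"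
  have "summable (\<lambda>k. (norm (\<delta> z k))\<^sup>2)" for z
    by (rule summable_finite[of "{0}"]) (auto simp: \<delta>_def)
  then have "(\<delta> x, \<delta> y) \<in> square_summable_pairs"
    by (simp add: square_summable_pairs_def)
  moreover have "(\<Sum>k. cinner (blinfun_apply A (\<delta> x k)) (\<delta> y k)) = cinner (blinfun_apply A x) y"
    for A :: "'h \<Rightarrow>\<^sub>L 'h"
    by (subst suminf_finite[of "{0}"]) (auto simp: \<delta>_def)
  ultimately show "((\<lambda>n. cinner (blinfun_apply (T n) x) y) \<longlongrightarrow> cinner (blinfun_apply Q x) y) F"
    using assms unfolding limitin_ultraweak_topology by fastforce
qed

text \<open>Dominated convergence for series: each term converges by strong convergence, and the
  uniform bound gives a summable majorant that does not depend on \<open>n\<close>.\<close>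

lemma bounded_strong_imp_ultraweak_limit:
  fixes T :: "nat \<Rightarrow> ('h::complex_hilbert_space \<Rightarrow>\<^sub>L 'h)"
  assumes lim: "limitin strong_operator_topology T Q sequentially"
    and bound: "\<And>n x. norm (blinfun_apply (T n) x) \<le> M * norm x"
  shows "limitin ultraweak_topology T Q sequentially"
  unfolding limitin_ultraweak_topology
proof (intro ballI, clarify)
  fix \<xi> \<eta> :: "nat \<Rightarrow> 'h"
  assume "(\<xi>, \<eta>) \<in> square_summable_pairs"
  then have sum: "summable (\<lambda>k. M * ((norm (\<xi> k))\<^sup>2 + (norm (\<eta> k))\<^sup>2))"
    by (auto simp: square_summable_pairs_def intro!: summable_mult summable_add)
  have M: "M * norm x \<ge> 0" for x :: 'h
    using bound[of 0 x] norm_ge_zero order_trans by blast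
  have "norm (cinner (blinfun_apply (T n) (\<xi> k)) (\<eta> k)) \<le> M * ((norm (\<xi> k))\<^sup>2 + (norm (\<eta> k))\<^sup>2)"
    for k n
  proof -
    have "norm (cinner (blinfun_apply (T n) (\<xi> k)) (\<eta> k))
        \<le> 2 * (norm (blinfun_apply (T n) (\<xi> k)) * norm (\<eta> k))"
      by (rule norm_cinner_le)
    also have "\<dots> \<le> 2 * (M * norm (\<xi> k) * norm (\<eta> k))"
      by (intro mult_left_mono mult_right_mono bound) auto
    \<comment> \<open>The inequality between arithmetic and geometric means, scaled by
      \<open>M\<close>. The sign of \<open>M\<close> is not assumed; \<open>bound\<close> yields it
      as soon as one of the two vectors is nonzero, hence the case split.\<close>
    also have "\<dots> \<le> M * ((norm (\<xi> k))\<^sup>2 + (norm (\<eta> k))\<^sup>2)"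
    proof (cases "norm (\<xi> k) = 0 \<and> norm (\<eta> k) = 0")
      case False
      then have "M \<ge> 0"
        using M[of "\<xi> k"] M[of "\<eta> k"] by (auto simp: zero_le_mult_iff)
      then have "M * (2 * norm (\<xi> k) * norm (\<eta> k)) \<le> M * ((norm (\<xi> k))\<^sup>2 + (norm (\<eta> k))\<^sup>2)"
        by (intro mult_left_mono sum_squares_bound)
      then show ?thesis
        by (simp add: mult_ac)
    qed auto
    finally show ?thesis .
  qed
  moreover have "(\<lambda>n. cinner (blinfun_apply (T n) (\<xi> k)) (\<eta> k))
      \<longlonglongrightarrow> cinner (blinfun_apply Q (\<xi> k)) (\<eta> k)" for k
    using lim by (intro tendsto_cinner_left) (simp add: limitin_strong_operator_topology)
  ultimately show "(\<lambda>n. \<Sum>k. cinner (blinfun_apply (T n) (\<xi> k)) (\<eta> k))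
      \<longlonglongrightarrow> (\<Sum>k. cinner (blinfun_apply Q (\<xi> k)) (\<eta> k))"
    using tannerys_theorem[where F = sequentially
        and a = "\<lambda>k n. cinner (blinfun_apply (T n) (\<xi> k)) (\<eta> k)", OF _ _ sum]
    by (auto simp: always_eventually)
qed

section \<open>Bounded monotone sequences of operators\<close>

text \<open>Positivity of \<open>D\<close> on \<open>x - D x / M\<close>.\<close>

lemma norm_sq_le_of_positive:
  fixes D :: "'a::real_inner \<Rightarrow>\<^sub>L 'a"
  assumes sym: "\<And>x y. inner (blinfun_apply D x) y = inner x (blinfun_apply D y)"
    and pos: "\<And>x. 0 \<le> inner (blinfun_apply D x) x"
    and le: "\<And>x. inner (blinfun_apply D x) x \<le> M * (norm x)\<^sup>2"
    and M: "0 < M"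
  shows "(norm (blinfun_apply D x))\<^sup>2 \<le> M * inner (blinfun_apply D x) x"
proof -
  define d where "d = blinfun_apply D x"
  have "0 \<le> inner (blinfun_apply D (x - (1 / M) *\<^sub>R d)) (x - (1 / M) *\<^sub>R d)"
    by (rule pos)
  also have "\<dots> = inner d x - 2 / M * (norm d)\<^sup>2 + (1 / M)\<^sup>2 * inner (blinfun_apply D d) d"
    using sym[of d x]
    by (simp add: blinfun.diff_right blinfun.scaleR_right inner_diff_left inner_diff_right
        power2_norm_eq_inner power_divide diff_divide_distrib flip: d_def)
      (simp add: power2_eq_square)
  also have "\<dots> \<le> inner d x - 2 / M * (norm d)\<^sup>2 + (1 / M)\<^sup>2 * (M * (norm d)\<^sup>2)"
    by (intro add_left_mono mult_left_mono le) auto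
  also have "\<dots> = inner d x - (norm d)\<^sup>2 / M"
    using M by (simp add: field_simps power2_eq_square)
  finally show ?thesis
    using M by (simp add: d_def field_simps)
qed

text \<open>The bound on the quadratic form is used twice: once inside
  \<open>norm_sq_le_of_positive\<close>, and once more on its right-hand side.\<close>

lemma norm_le_of_positive:
  fixes D :: "'a::real_inner \<Rightarrow>\<^sub>L 'a"
  assumes sym: "\<And>x y. inner (blinfun_apply D x) y = inner x (blinfun_apply D y)"
    and pos: "\<And>x. 0 \<le> inner (blinfun_apply D x) x"
    and le: "\<And>x. inner (blinfun_apply D x) x \<le> M * (norm x)\<^sup>2"
    and M: "0 < M"
  shows "norm (blinfun_apply D x) \<le> M * norm x"
proof -
  have "(norm (blinfun_apply D x))\<^sup>2 \<le> M * (M * (norm x)\<^sup>2)"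
    by (rule order_trans[OF norm_sq_le_of_positive[OF assms]]) (use le M in auto)
  then have "(norm (blinfun_apply D x))\<^sup>2 \<le> (M * norm x)\<^sup>2"
    by (simp add: power2_eq_square mult_ac)
  then show ?thesis
    by (rule power2_le_imp_le) (use M in simp)
qed

text \<open>The real sequences of quadratic forms are monotone and bounded, hence Cauchy. By
  \<open>norm_sq_le_of_positive\<close>, applied to the positive differences, the vectors are then
  Cauchy as well. The uniform bound is also exported because the passage to the ultraweak topology
  requires it.\<close>

lemma monotone_operators_converge:
  fixes T :: "nat \<Rightarrow> ('a::{real_inner, complete_space} \<Rightarrow>\<^sub>L 'a)"
  assumes sym: "\<And>n x y. inner (blinfun_apply (T n) x) y = inner x (blinfun_apply (T n) y)"
    and pos: "\<And>x. 0 \<le> inner (blinfun_apply (T 0) x) x"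
    and mono: "\<And>n x. inner (blinfun_apply (T n) x) x \<le> inner (blinfun_apply (T (Suc n)) x) x"
    and le: "\<And>n x. inner (blinfun_apply (T n) x) x \<le> M * (norm x)\<^sup>2"
    and M: "0 < M"
  obtains Q where "limitin strong_operator_topology T Q sequentially"
    and "\<And>n x. norm (blinfun_apply (T n) x) \<le> M * norm x"
proof -
  have incr: "inner (blinfun_apply (T m) x) x \<le> inner (blinfun_apply (T n) x) x" if "m \<le> n" for m n x
    using lift_Suc_mono_le[of "\<lambda>n. inner (blinfun_apply (T n) x) x", OF mono that] .
  have pos': "0 \<le> inner (blinfun_apply (T n) x) x" for n x
    using pos[of x] incr[of 0 n x] by simp
  have bound: "norm (blinfun_apply (T n) x) \<le> M * norm x" for n x
    by (rule norm_le_of_positive[OF sym pos' le M])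
  have step: "(norm (blinfun_apply (T n) x - blinfun_apply (T m) x))\<^sup>2
      \<le> M * (inner (blinfun_apply (T n) x) x - inner (blinfun_apply (T m) x) x)" if "m \<le> n" for m n x
  proof -
    \<comment> \<open>The differences obey the same constant \<open>M\<close>, because subtracting
      the positive form of \<open>T m\<close> only lowers the value.\<close>
    have "inner (blinfun_apply (T n) z) z - inner (blinfun_apply (T m) z) z \<le> M * (norm z)\<^sup>2" for z
      using le[of n z] pos'[of m z] by linarith
    then show ?thesis
      using norm_sq_le_of_positive[of "T n - T m" M x] sym incr[OF that] M
      by (simp add: blinfun.diff_left inner_diff_left inner_diff_right)
  qed
  have "convergent (\<lambda>n. blinfun_apply (T n) x)" for x
  proof -
    have "Cauchy (\<lambda>n. inner (blinfun_apply (T n) x) x)"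
      by (intro convergent_Cauchy Bseq_mono_convergent BseqI'[of _ "M * (norm x)\<^sup>2"])
        (use pos' le incr in \<open>auto simp: abs_of_nonneg\<close>)
    have "Cauchy (\<lambda>n. blinfun_apply (T n) x)"
    proof (rule metric_CauchyI)
      fix e :: real
      assume "0 < e"
      then obtain K where K: "\<And>m n. m \<ge> K \<Longrightarrow> n \<ge> K \<Longrightarrow>
          dist (inner (blinfun_apply (T m) x) x) (inner (blinfun_apply (T n) x) x) < e\<^sup>2 / M"
        using \<open>Cauchy (\<lambda>n. inner _ _)\<close> M by (metis metric_CauchyD divide_pos_pos zero_less_power)
      have close: "dist (blinfun_apply (T n) x) (blinfun_apply (T m) x) < e"
        if "K \<le> m" "m \<le> n" for m n
      proof -
        have "inner (blinfun_apply (T n) x) x - inner (blinfun_apply (T m) x) x < e\<^sup>2 / M"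
          using K[of m n] that by (simp add: dist_real_def)
        then have "M * (inner (blinfun_apply (T n) x) x - inner (blinfun_apply (T m) x) x) < e\<^sup>2"
          using M by (simp add: field_simps)
        then have "(norm (blinfun_apply (T n) x - blinfun_apply (T m) x))\<^sup>2 < e\<^sup>2"
          using step[OF that(2), of x] by simp
        then show ?thesis
          using \<open>0 < e\<close> power_less_imp_less_base[of _ 2 e] by (simp add: dist_norm)
      qed
      then show "\<exists>K. \<forall>m\<ge>K. \<forall>n\<ge>K. dist (blinfun_apply (T m) x) (blinfun_apply (T n) x) < e"
        by (metis dist_commute nle_le)
    qed
    then show ?thesis
      by (rule Cauchy_convergent)
  qed
  then have lim: "(\<lambda>n. blinfun_apply (T n) x) \<longlonglongrightarrow> lim (\<lambda>n. blinfun_apply (T n) x)" for x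
    by (simp add: convergent_LIMSEQ_iff)
  have "bounded_linear (\<lambda>x. lim (\<lambda>n. blinfun_apply (T n) x))"
  proof (rule bounded_linear_intro[where K = M])
    fix x y :: 'a and r :: real
    show "lim (\<lambda>n. blinfun_apply (T n) (x + y))
        = lim (\<lambda>n. blinfun_apply (T n) x) + lim (\<lambda>n. blinfun_apply (T n) y)"
      using tendsto_add[OF lim[of x] lim[of y]] by (simp add: blinfun.add_right limI)
    show "lim (\<lambda>n. blinfun_apply (T n) (r *\<^sub>R x)) = r *\<^sub>R lim (\<lambda>n. blinfun_apply (T n) x)"
      using tendsto_scaleR[OF tendsto_const lim[of x]] by (simp add: blinfun.scaleR_right limI)
    show "norm (lim (\<lambda>n. blinfun_apply (T n) x)) \<le> norm x * M"
      using LIMSEQ_le_const2[OF tendsto_norm[OF lim[of x]], of "norm x * M"] bound[of _ x]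
      by (auto simp: mult.commute)
  qed
  then have "limitin strong_operator_topology T (Blinfun (\<lambda>x. lim (\<lambda>n. blinfun_apply (T n) x)))
      sequentially"
    using lim by (simp add: limitin_strong_operator_topology bounded_linear_Blinfun_apply)
  then show thesis
    using bound that by blast
qed

section \<open>Unital completely positive maps\<close>

definition positive_op :: "('h::complex_hilbert_space \<Rightarrow>\<^sub>L 'h) \<Rightarrow> bool" where
  "positive_op A \<longleftrightarrow> (\<forall>x. cinner (blinfun_apply A x) x \<in> \<real>\<^sub>\<ge>\<^sub>0)"

lemma positive_op_nonneg: "positive_op A \<Longrightarrow> 0 \<le> inner (blinfun_apply A x) x"
  by (metis Re_cinner complex_nonneg_Reals_iff positive_op_def)

text \<open>Positivity makes the quadratic form real, so its imaginary part vanishes identically.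
  Polarizing at \<open>x + y\<close> and then replacing \<open>y\<close> by
  \<open>\<i> *\<^sub>C y\<close> gives symmetry; this last substitution relies on complex linearity
  of \<open>A\<close>.\<close>

lemma positive_op_symmetric:
  assumes "A \<in> bounded_clinear_ops" "positive_op A"
  shows "inner (blinfun_apply A x) y = inner x (blinfun_apply A y)"
proof -
  have 0: "inner (blinfun_apply A x) (\<i> *\<^sub>C x) = 0" for x
    using assms(2) by (metis Im_cinner complex_nonneg_Reals_iff positive_op_def)
  have "inner (blinfun_apply A x) (\<i> *\<^sub>C y) + inner (blinfun_apply A y) (\<i> *\<^sub>C x) = 0" for x y
    using 0[of "x + y"] 0[of x] 0[of y]
    by (simp add: blinfun.add_right scaleC_add_right inner_add_left inner_add_right)
  from this[of x "\<i> *\<^sub>C y"] have "inner (\<i> *\<^sub>C blinfun_apply A y) (\<i> *\<^sub>C x) = inner (blinfun_apply A x) y"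
    using assms(1) by (simp add: scaleC_i_i bounded_clinear_ops_def)
  moreover have "inner (\<i> *\<^sub>C blinfun_apply A y) (\<i> *\<^sub>C x) = inner (blinfun_apply A y) x"
    by (simp flip: Re_cinner add: cinner_scaleC_left cinner_scaleC_right)
  ultimately show ?thesis
    by (simp add: inner_commute)
qed

text \<open>The quadratic form vanishes, so any positive constant bounds it;
  \<open>norm_sq_le_of_positive\<close> with constant 1 then kills \<open>A x\<close>.\<close>

lemma positive_op_antisym:
  assumes "A \<in> bounded_clinear_ops" "positive_op A" "positive_op (- A)"
  shows "A = 0"
proof (rule blinfun_eqI)
  fix x
  have 0: "inner (blinfun_apply A y) y = 0" for y
    using positive_op_nonneg[OF assms(2), of y] positive_op_nonneg[OF assms(3), of y]
    by (simp add: blinfun.minus_left)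
  have "(norm (blinfun_apply A x))\<^sup>2 \<le> 1 * inner (blinfun_apply A x) x"
    using positive_op_symmetric[OF assms(1,2)] 0 by (intro norm_sq_le_of_positive) auto
  then show "blinfun_apply A x = blinfun_apply 0 x"
    by (simp add: 0)
qed

lemma positive_op_add: "positive_op A \<Longrightarrow> positive_op B \<Longrightarrow> positive_op (A + B)"
  unfolding positive_op_def
  by (simp add: blinfun.add_left cinner_add_left complex_nonneg_Reals_iff)

lemma positive_op_limit:
  assumes lim: "limitin weak_operator_topology T Q F" and pos: "\<forall>\<^sub>F n in F. positive_op (T n)"
    and "F \<noteq> bot"
  shows "positive_op Q"
  unfolding positive_op_def
proof
  fix x
  show "cinner (blinfun_apply Q x) x \<in> \<real>\<^sub>\<ge>\<^sub>0"
  proof (rule Lim_in_closed_set[OF closed_nonneg_Reals_complex _ \<open>F \<noteq> bot\<close>])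
    show "((\<lambda>n. cinner (blinfun_apply (T n) x) x) \<longlongrightarrow> cinner (blinfun_apply Q x) x) F"
      using lim by (simp add: limitin_weak_operator_topology)
    show "\<forall>\<^sub>F n in F. cinner (blinfun_apply (T n) x) x \<in> \<real>\<^sub>\<ge>\<^sub>0"
      using pos by (rule eventually_mono) (simp add: positive_op_def)
  qed
qed

lemma scaleC_op_minus_one: "scaleC_op (-1) A = - A"
  by (rule blinfun_eqI) (simp add: scaleC_op.rep_eq scaleC_minus_one blinfun.minus_left)

lemma is_adjoint_add:
  "is_adjoint A A' \<Longrightarrow> is_adjoint B B' \<Longrightarrow> is_adjoint (A + B) (A' + B')"
  by (simp add: is_adjoint_def blinfun.add_left cinner_add_left cinner_add_right)

lemma is_adjoint_scaleC: "is_adjoint A A' \<Longrightarrow> is_adjoint (scaleC_op c A) (scaleC_op (cnj c) A')"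
  by (simp add: is_adjoint_def scaleC_op.rep_eq cinner_scaleC_left cinner_scaleC_right)

text \<open>Every nonzero index counts as 1. Hence applying a map entrywise is an identity of
  functions on all indices, not only on those below 2.\<close>

definition block_matrix :: "'a \<Rightarrow> 'a \<Rightarrow> 'a \<Rightarrow> 'a \<Rightarrow> nat \<Rightarrow> nat \<Rightarrow> 'a" where
  "block_matrix A B C D i j =
     (if i = 0 then if j = 0 then A else B else if j = 0 then C else D)"

lemma positive_block_matrix:
  "positive_matrix 2 (block_matrix A B C D) \<longleftrightarrow>
     (\<forall>u v. cinner (blinfun_apply A u) u + cinner (blinfun_apply B v) u
        + cinner (blinfun_apply C u) v + cinner (blinfun_apply D v) v \<in> \<real>\<^sub>\<ge>\<^sub>0)"
  (is "_ \<longleftrightarrow> (\<forall>u v. ?Q u v)")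
proof -
  have "positive_matrix 2 (block_matrix A B C D) \<longleftrightarrow> (\<forall>\<xi> :: nat \<Rightarrow> 'a. ?Q (\<xi> 0) (\<xi> (Suc 0)))"
    by (simp add: positive_matrix_def block_matrix_def numeral_2_eq_2 add.assoc)
  also have "\<dots> \<longleftrightarrow> (\<forall>u v. ?Q u v)"
  proof (intro iffI allI)
    fix u v
    assume "\<forall>\<xi> :: nat \<Rightarrow> 'a. ?Q (\<xi> 0) (\<xi> (Suc 0))"
    from this[rule_format, of "\<lambda>i. if i = 0 then u else v"] show "?Q u v"
      by simp
  qed auto
  finally show ?thesis .
qed

text \<open>Normality is left out so that the results also apply to a projection \<open>E\<close>
  onto the fixed points, about which no continuity is known.\<close>

locale unital_cp_map =
  fixes N :: "('h::complex_hilbert_space \<Rightarrow>\<^sub>L 'h) set"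
    and P :: "('h \<Rightarrow>\<^sub>L 'h) \<Rightarrow> ('h \<Rightarrow>\<^sub>L 'h)"
  assumes vn: "von_neumann_algebra N"
    and cp: "completely_positive_on N P"
    and P_id: "P id_blinfun = id_blinfun"
begin

lemma
  shows N_clinear: "A \<in> N \<Longrightarrow> A \<in> bounded_clinear_ops"
    and N_id: "id_blinfun \<in> N"
    and N_add: "A \<in> N \<Longrightarrow> B \<in> N \<Longrightarrow> A + B \<in> N"
    and N_scale: "A \<in> N \<Longrightarrow> scaleC_op c A \<in> N"
    and N_mult: "A \<in> N \<Longrightarrow> B \<in> N \<Longrightarrow> A o\<^sub>L B \<in> N"
    and N_adjoint: "A \<in> N \<Longrightarrow> \<exists>B\<in>N. is_adjoint A B"
    and N_closed: "closedin weak_operator_topology N"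
  using vn unfolding von_neumann_algebra_def by blast+

lemma
  shows P_N: "A \<in> N \<Longrightarrow> P A \<in> N"
    and P_add: "A \<in> N \<Longrightarrow> B \<in> N \<Longrightarrow> P (A + B) = P A + P B"
    and P_scale: "A \<in> N \<Longrightarrow> P (scaleC_op c A) = scaleC_op c (P A)"
  using cp unfolding completely_positive_on_def clinear_map_on_def by blast+

lemma N_diff: "A \<in> N \<Longrightarrow> B \<in> N \<Longrightarrow> A - B \<in> N"
  using N_add[of A "scaleC_op (-1) B"] N_scale[of B "-1"] by (simp add: scaleC_op_minus_one)

lemma P_diff: "A \<in> N \<Longrightarrow> B \<in> N \<Longrightarrow> P (A - B) = P A - P B"
  using P_add[of A "scaleC_op (-1) B"] P_scale[of B "-1"] N_scale[of B "-1"]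
  by (simp add: scaleC_op_minus_one)

text \<open>Complete positivity for matrices of size 1.\<close>

lemma P_positive:
  assumes "A \<in> N" "positive_op A"
  shows "positive_op (P A)"
proof -
  have "positive_matrix 1 (\<lambda>_ _. B) \<longleftrightarrow> positive_op B" for B :: "'h \<Rightarrow>\<^sub>L 'h"
  proof
    assume pos: "positive_matrix 1 (\<lambda>_ _. B)"
    show "positive_op B"
      unfolding positive_op_def
    proof
      fix x
      show "cinner (blinfun_apply B x) x \<in> \<real>\<^sub>\<ge>\<^sub>0"
        using pos[unfolded positive_matrix_def, rule_format, of "\<lambda>_. x"] by simp
    qed
  qed (simp add: positive_matrix_def positive_op_def)
  moreover have "positive_matrix 1 (\<lambda>_ _. A) \<Longrightarrow> positive_matrix 1 (\<lambda>_ _. P A)"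
    using conjunct2[OF cp[unfolded completely_positive_on_def], rule_format, of 1 "\<lambda>_ _. A"] assms(1)
    by simp
  ultimately show ?thesis
    using assms(2) by blast
qed

text \<open>The matrix with rows (1, \<open>A\<close>) and (\<open>A'\<close>,
  \<open>A' o\<^sub>L A\<close>) is positive, its form being the squared norm of
  \<open>u + A v\<close>. Unitality keeps the corner entry when \<open>P\<close> is applied
  entrywise. Both adjoint preservation and the Kadison-Schwarz inequality are read off from this
  form.\<close>

lemma P_block_matrix:
  assumes "is_adjoint A A'" "A \<in> N" "A' \<in> N"
  shows "cinner u u + cinner (blinfun_apply (P A) v) u + cinner (blinfun_apply (P A') u) v
      + cinner (blinfun_apply (P (A' o\<^sub>L A)) v) v \<in> \<real>\<^sub>\<ge>\<^sub>0"
proof -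
  let ?B = "block_matrix id_blinfun A A' (A' o\<^sub>L A)"
  have "cinner u u + cinner (blinfun_apply A v) u + cinner (blinfun_apply A' u) v
      + cinner (blinfun_apply A' (blinfun_apply A v)) v
      = cinner (u + blinfun_apply A v) (u + blinfun_apply A v)" for u v
    using is_adjoint_sym[OF assms(1)]
    by (simp add: is_adjoint_def cinner_add_left cinner_add_right)
  then have "positive_matrix 2 ?B"
    by (simp add: positive_block_matrix cinner_self)
  moreover have "\<forall>i<2. \<forall>j<2. ?B i j \<in> N"
    using assms N_id N_mult by (simp add: block_matrix_def)
  ultimately have "positive_matrix 2 (\<lambda>i j. P (?B i j))"
    using cp unfolding completely_positive_on_def by blast
  also have "(\<lambda>i j. P (?B i j)) = block_matrix id_blinfun (P A) (P A') (P (A' o\<^sub>L A))"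
    by (simp add: fun_eq_iff block_matrix_def P_id)
  finally show ?thesis
    by (simp add: positive_block_matrix)
qed

lemma P_adjoint:
  assumes "is_adjoint A A'" "A \<in> N" "A' \<in> N"
  shows "is_adjoint (P A) (P A')"
  unfolding is_adjoint_def
proof (intro allI)
  fix v u
  \<comment> \<open>The case \<open>u = 0\<close> shows that the last term of the block form is
    real, and \<open>cinner u u\<close> is real too, so the two cross terms have a real sum. Putting
    \<open>\<i> *\<^sub>C v\<close> for \<open>v\<close> then compares their real parts, making them
    conjugate.\<close>
  have Im: "Im (cinner (blinfun_apply (P A) v) u + cinner (blinfun_apply (P A') u) v) = 0" for u v
    using P_block_matrix[OF assms, of u v] P_block_matrix[OF assms, of 0 v]
    by (simp add: complex_nonneg_Reals_iff cinner_self)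
  have "blinfun_apply (P A) (\<i> *\<^sub>C v) = \<i> *\<^sub>C blinfun_apply (P A) v"
    using N_clinear[OF P_N[OF assms(2)]] by (simp add: bounded_clinear_ops_def)
  then have "cinner (blinfun_apply (P A) v) u = cnj (cinner (blinfun_apply (P A') u) v)"
    using Im[of v u] Im[of "\<i> *\<^sub>C v" u]
    by (simp add: complex_eq_iff cinner_scaleC_left cinner_scaleC_right)
  then show "cinner (blinfun_apply (P A) v) u = cinner v (blinfun_apply (P A') u)"
    by (metis cinner_commute)
qed

text \<open>Completing the square: \<open>u = - P A v\<close> in the block form cancels
  \<open>cinner u u\<close> against one of the cross terms and leaves the claimed
  difference.\<close>

lemma kadison_schwarz:
  assumes "is_adjoint A A'" "A \<in> N" "A' \<in> N"
  shows "positive_op (P (A' o\<^sub>L A) - (P A' o\<^sub>L P A))"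
  unfolding positive_op_def
proof
  fix v
  show "cinner (blinfun_apply (P (A' o\<^sub>L A) - (P A' o\<^sub>L P A)) v) v \<in> \<real>\<^sub>\<ge>\<^sub>0"
    using P_block_matrix[OF assms, of "- blinfun_apply (P A) v" v]
    by (simp add: blinfun.diff_left blinfun.minus_right cinner_diff_left cinner_minus_left
        cinner_minus_right)
qed

lemma H_adjoint:
  assumes "A \<in> H_infinity N P" "is_adjoint A A'" "A' \<in> N"
  shows "A' \<in> H_infinity N P"
proof -
  have "A \<in> N" "P A = A"
    using assms(1) by (auto simp: H_infinity_def)
  then have "is_adjoint A (P A')"
    using P_adjoint[OF assms(2) _ assms(3)] by simp
  then have "P A' = A'"
    using assms(2) by (rule is_adjoint_unique)
  then show ?thesis
    using assms(3) by (simp add: H_infinity_def)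
qed

lemma H_N: "A \<in> H_infinity N P \<Longrightarrow> A \<in> N"
  by (simp add: H_infinity_def)

lemma H_add: "A \<in> H_infinity N P \<Longrightarrow> B \<in> H_infinity N P \<Longrightarrow> A + B \<in> H_infinity N P"
  by (simp add: H_infinity_def N_add P_add)

lemma H_scale: "A \<in> H_infinity N P \<Longrightarrow> scaleC_op c A \<in> H_infinity N P"
  by (simp add: H_infinity_def N_scale P_scale)

lemma funpow_N: "A \<in> N \<Longrightarrow> (P ^^ n) A \<in> N"
  by (induction n) (auto simp: P_N)

lemma funpow_add_op:
  "A \<in> N \<Longrightarrow> B \<in> N \<Longrightarrow> (P ^^ n) (A + B) = (P ^^ n) A + (P ^^ n) B"
  by (induction n) (auto simp: P_add funpow_N)

lemma funpow_scale: "A \<in> N \<Longrightarrow> (P ^^ n) (scaleC_op c A) = scaleC_op c ((P ^^ n) A)"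
  by (induction n) (auto simp: P_scale funpow_N)

lemma funpow_positive_diff:
  assumes "A \<in> N" "B \<in> N" "positive_op (A - B)"
  shows "positive_op ((P ^^ n) A - (P ^^ n) B)"
proof (induction n)
  case (Suc n)
  then show ?case
    using P_positive[of "(P ^^ n) A - (P ^^ n) B"] assms by (simp add: P_diff N_diff funpow_N)
qed (simp add: assms)

lemma funpow_fixed: "P A = A \<Longrightarrow> (P ^^ n) A = A"
  by (induction n) auto

end

text \<open>The identity lies in the range of \<open>E\<close>, and an idempotent fixes its
  range.\<close>

lemma cp_projection_unital:
  assumes "von_neumann_algebra N" "cp_projection_onto N S E" "id_blinfun \<in> S"
  shows "unital_cp_map N E"
proof
  obtain A where "A \<in> N" "id_blinfun = E A"
    using assms unfolding cp_projection_onto_def by blast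
  then show "E id_blinfun = id_blinfun"
    using assms(2) unfolding cp_projection_onto_def by metis
qed (use assms in \<open>auto simp: cp_projection_onto_def\<close>)

section \<open>Normal maps and the limits of their iterates\<close>

locale normal_ucp_map = unital_cp_map +
  assumes normal: "normal_on N P"
begin

text \<open>The only use of normality. The bound upgrades strong to ultraweak convergence,
  \<open>P\<close> may then be applied to the limit, and the shifted sequence converges weakly to
  both \<open>P Q\<close> and \<open>Q\<close>. That \<open>Q\<close> lies in \<open>N\<close> comes
  from weak closedness.\<close>

lemma limit_fixed:
  assumes A: "A \<in> N" and lim: "limitin strong_operator_topology (\<lambda>n. (P ^^ n) A) Q sequentially"
    and bound: "\<And>n x. norm (blinfun_apply ((P ^^ n) A) x) \<le> M * norm x"
  shows "Q \<in> H_infinity N P"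
proof -
  note wlim = strong_imp_weak_limit[OF lim]
  have "Q \<in> N"
    by (rule limitin_closedin[OF wlim N_closed]) (auto simp: A funpow_N)
  have "limitin (subtopology ultraweak_topology N) (\<lambda>n. (P ^^ n) A) Q sequentially"
    using bounded_strong_imp_ultraweak_limit[OF lim bound] \<open>Q \<in> N\<close>
    by (simp add: limitin_subtopology A funpow_N)
  then have "limitin (subtopology ultraweak_topology N) (P \<circ> (\<lambda>n. (P ^^ n) A)) (P Q) sequentially"
    using normal unfolding normal_on_def by (intro continuous_map_limit)
  then have "limitin weak_operator_topology (\<lambda>n. (P ^^ Suc n) A) (P Q) sequentially"
    by (intro ultraweak_imp_weak_limit) (simp add: limitin_subtopology o_def)
  moreover have "limitin weak_operator_topology (\<lambda>n. (P ^^ Suc n) A) Q sequentially"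
    using wlim LIMSEQ_Suc unfolding limitin_weak_operator_topology by blast
  ultimately have "P Q = Q"
    by (rule limitin_weak_operator_topology_unique) simp
  with \<open>Q \<in> N\<close> show ?thesis
    by (simp add: H_infinity_def)
qed

lemma square_limit:
  assumes A: "A \<in> H_infinity N P" and adj: "is_adjoint A A'" and A': "A' \<in> N"
  obtains Q where "Q \<in> H_infinity N P"
    and "limitin strong_operator_topology (\<lambda>n. (P ^^ n) (A' o\<^sub>L A)) Q sequentially"
    and "positive_op (Q - (A' o\<^sub>L A))"
proof -
  define Z where "Z = A' o\<^sub>L A"
  \<comment> \<open>The added 1 makes \<open>M\<close> positive even when \<open>A = 0\<close>, as
    \<open>monotone_operators_converge\<close> demands.\<close>
  define M where "M = (norm A)\<^sup>2 + 1"
  have "0 < M"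
    by (simp add: M_def add_nonneg_pos)
  have AN: "A \<in> N" and PA: "P A = A"
    using A by (auto simp: H_infinity_def)
  have PA': "P A' = A'"
    using H_adjoint[OF A adj A'] by (simp add: H_infinity_def)
  have Z: "Z \<in> N"
    using AN A' by (simp add: Z_def N_mult)
  have cZ: "cinner (blinfun_apply Z x) x = complex_of_real ((norm (blinfun_apply A x))\<^sup>2)" for x
    using is_adjoint_sym[OF adj] by (simp add: Z_def is_adjoint_def cinner_self)
  have Z0: "positive_op Z"
    by (simp add: positive_op_def cZ)
  have ZM: "positive_op (scaleC_op (complex_of_real M) id_blinfun - Z)"
    unfolding positive_op_def
  proof
    fix x
    have "(norm (blinfun_apply A x))\<^sup>2 \<le> (norm A * norm x)\<^sup>2"
      by (intro power_mono norm_blinfun) auto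
    also have "\<dots> \<le> M * (norm x)\<^sup>2"
      by (simp add: M_def power_mult_distrib distrib_right)
    finally show "cinner (blinfun_apply (scaleC_op (complex_of_real M) id_blinfun - Z) x) x \<in> \<real>\<^sub>\<ge>\<^sub>0"
      by (simp add: blinfun.diff_left scaleC_op.rep_eq cinner_diff_left cinner_scaleC_left cZ
          cinner_self complex_nonneg_Reals_iff)
  qed
  \<comment> \<open>As \<open>A\<close> and \<open>A'\<close> are fixed, Kadison-Schwarz reads
    \<open>P Z \<ge> Z\<close>; the iterates of \<open>P\<close> preserve this order.\<close>
  have incr: "positive_op ((P ^^ Suc n) Z - (P ^^ n) Z)" for n
    using funpow_positive_diff[OF P_N[OF Z] Z, of n] kadison_schwarz[OF adj AN A'] PA PA'
    by (simp add: Z_def funpow_swap1)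
  have pos: "positive_op ((P ^^ n) Z)" for n
  proof (induction n)
    case (Suc n)
    then show ?case
      using P_positive[OF funpow_N[OF Z]] by simp
  qed (simp add: Z0)
  \<comment> \<open>Scalar multiples of the identity are fixed, so the upper bound on
    \<open>Z\<close> passes unchanged to all iterates.\<close>
  have "P (scaleC_op (complex_of_real M) id_blinfun) = scaleC_op (complex_of_real M) id_blinfun"
    by (simp add: P_scale N_id P_id)
  then have le: "positive_op (scaleC_op (complex_of_real M) id_blinfun - (P ^^ n) Z)" for n
    using funpow_positive_diff[OF N_scale[OF N_id] Z ZM, of n] by (simp add: funpow_fixed)
  obtain Q where Q: "limitin strong_operator_topology (\<lambda>n. (P ^^ n) Z) Q sequentially"
    and bound: "\<And>n x. norm (blinfun_apply ((P ^^ n) Z) x) \<le> M * norm x"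
  proof (rule monotone_operators_converge[of "\<lambda>n. (P ^^ n) Z" M])
    show "inner (blinfun_apply ((P ^^ n) Z) x) y = inner x (blinfun_apply ((P ^^ n) Z) y)" for n x y
      by (rule positive_op_symmetric[OF N_clinear[OF funpow_N[OF Z]] pos])
    show "0 \<le> inner (blinfun_apply ((P ^^ 0) Z) x) x" for x
      by (rule positive_op_nonneg[OF pos])
    show "inner (blinfun_apply ((P ^^ n) Z) x) x \<le> inner (blinfun_apply ((P ^^ Suc n) Z) x) x" for n x
      using positive_op_nonneg[OF incr[of n], of x] by (simp add: blinfun.diff_left inner_diff_left)
    show "inner (blinfun_apply ((P ^^ n) Z) x) x \<le> M * (norm x)\<^sup>2" for n x
      using positive_op_nonneg[OF le[of n], of x]
      by (simp add: blinfun.diff_left inner_diff_left scaleC_op.rep_eq scaleC_of_real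
          power2_norm_eq_inner)
  qed (use \<open>0 < M\<close> in auto)
  have "positive_op ((P ^^ n) Z - Z)" for n
  proof (induction n)
    case 0
    then show ?case
      by (simp add: positive_op_def)
  next
    case (Suc n)
    then show ?case
      using positive_op_add[OF incr[of n]] by force
  qed
  moreover have "limitin weak_operator_topology (\<lambda>n. (P ^^ n) Z - Z) (Q - Z) sequentially"
    using strong_imp_weak_limit[OF Q]
    by (auto simp: limitin_weak_operator_topology blinfun.diff_left cinner_diff_left
        intro!: tendsto_diff)
  ultimately have "positive_op (Q - Z)"
    by (intro positive_op_limit) auto
  then show thesis
    using that Q limit_fixed[OF Z Q bound] by (simp add: Z_def)
qed

text \<open>If \<open>Q\<close> is the limit of \<open>P\<^sup>n(A\<^sup>* A)\<close>, then \<open>E(A\<^sup>* A) \<le> E Q = Q\<close>. Conversely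
  \<open>A\<^sup>* A \<le> E(A\<^sup>* A)\<close>, and the right-hand side is fixed by \<open>P\<close>, so
  \<open>P\<^sup>n(A\<^sup>* A) \<le> E(A\<^sup>* A)\<close> for all \<open>n\<close>.\<close>

lemma square_projection:
  assumes A: "A \<in> H_infinity N P" and adj: "is_adjoint A A'" and A': "A' \<in> N"
    and Q: "Q \<in> H_infinity N P" "positive_op (Q - (A' o\<^sub>L A))"
    and lim: "limitin strong_operator_topology (\<lambda>n. (P ^^ n) (A' o\<^sub>L A)) Q sequentially"
    and E: "cp_projection_onto N (H_infinity N P) E"
  shows "E (A' o\<^sub>L A) = Q"
proof -
  define Z where "Z = A' o\<^sub>L A"
  interpret E: unital_cp_map N E
    by (rule cp_projection_unital[OF vn E]) (simp add: H_infinity_def N_id P_id)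
  have E_H: "E B \<in> H_infinity N P" if "B \<in> N" for B
    using E that unfolding cp_projection_onto_def by blast
  have E_fixed: "E B = B" if "B \<in> H_infinity N P" for B
    using E that unfolding cp_projection_onto_def by (metis imageE)
  have Z: "Z \<in> N"
    using A A' by (simp add: Z_def N_mult H_N)
  have EZ: "E Z \<in> N" "P (E Z) = E Z"
    using E_H[OF Z] by (auto simp: H_infinity_def)
  have "positive_op (Q - E Z)"
    using E.P_positive[of "Q - Z"] Q Z by (simp add: N_diff H_N E.P_diff E_fixed Z_def)
  moreover have "positive_op (E Z - Q)"
  proof -
    have "positive_op (E Z - Z)"
      using E.kadison_schwarz[OF adj H_N[OF A] A'] E_fixed[OF A] E_fixed[OF H_adjoint[OF A adj A']]
      by (simp add: Z_def)
    then have "positive_op (E Z - (P ^^ n) Z)" for n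
      using funpow_positive_diff[OF EZ(1) Z, of n] by (simp add: funpow_fixed EZ)
    moreover have "limitin weak_operator_topology (\<lambda>n. E Z - (P ^^ n) Z) (E Z - Q) sequentially"
      using strong_imp_weak_limit[OF lim]
      by (auto simp: limitin_weak_operator_topology blinfun.diff_left cinner_diff_left Z_def
          intro!: tendsto_diff)
    ultimately show ?thesis
      by (intro positive_op_limit) auto
  qed
  ultimately have "E Z - Q = 0"
    using EZ(1) H_N[OF Q(1)] by (intro positive_op_antisym N_clinear N_diff) auto
  then show ?thesis
    by (simp add: Z_def)
qed

text \<open>Both the strong limit and the value under every projection depend linearly on
  \<open>A\<close>. Bundling them with a common \<open>Q\<close> lets a single polarization carry
  both from squares to products.\<close>

definition has_limit :: "('a \<Rightarrow>\<^sub>L 'a) \<Rightarrow> ('a \<Rightarrow>\<^sub>L 'a) \<Rightarrow> bool" where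
  "has_limit A Q \<longleftrightarrow> A \<in> N \<and>
     limitin strong_operator_topology (\<lambda>n. (P ^^ n) A) Q sequentially \<and>
     (\<forall>E. cp_projection_onto N (H_infinity N P) E \<longrightarrow> E A = Q)"

lemma has_limit_square:
  assumes "A \<in> H_infinity N P" "is_adjoint A A'" "A' \<in> N"
  shows "\<exists>Q. has_limit (A' o\<^sub>L A) Q"
proof -
  obtain Q where "Q \<in> H_infinity N P" "positive_op (Q - (A' o\<^sub>L A))"
    "limitin strong_operator_topology (\<lambda>n. (P ^^ n) (A' o\<^sub>L A)) Q sequentially"
    using square_limit[OF assms] .
  moreover have "A' o\<^sub>L A \<in> N"
    using assms by (simp add: N_mult H_infinity_def)
  ultimately show ?thesis
    using square_projection[OF assms] unfolding has_limit_def by blast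
qed

lemma has_limit_add:
  assumes "has_limit A Q" "has_limit B R"
  shows "has_limit (A + B) (Q + R)"
  using assms unfolding has_limit_def limitin_strong_operator_topology
  by (auto simp: N_add funpow_add_op blinfun.add_left cp_projection_onto_def
      completely_positive_on_def clinear_map_on_def intro: tendsto_add)

lemma has_limit_scale:
  assumes "has_limit A Q"
  shows "has_limit (scaleC_op c A) (scaleC_op c Q)"
  using assms unfolding has_limit_def limitin_strong_operator_topology
  by (auto simp: N_scale funpow_scale scaleC_op.rep_eq cp_projection_onto_def
      completely_positive_on_def clinear_map_on_def intro: tendsto_scaleC)

lemma has_limit_mult:
  assumes A: "A \<in> H_infinity N P" and B: "B \<in> H_infinity N P"
  shows "\<exists>Q. has_limit (A o\<^sub>L B) Q"
proof -
  obtain A' B' where A': "is_adjoint A A'" "A' \<in> N" and B': "is_adjoint B B'" "B' \<in> N"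
    using A B N_adjoint by (meson H_N)
  \<comment> \<open>\<open>B + c A'\<close> has adjoint \<open>B' + cnj c A\<close>, so each
    \<open>S c\<close> is a square. In its expansion \<open>A o\<^sub>L B\<close> carries the
    coefficient \<open>cnj c\<close>, and the other terms carry 1, \<open>c\<close> and
    \<open>cnj c * c\<close>. Weighting by \<open>c\<close> and summing over the fourth roots of
    unity leaves four times \<open>A o\<^sub>L B\<close>.\<close>
  define S where "S c = (B' + scaleC_op (cnj c) A) o\<^sub>L (B + scaleC_op c A')" for c
  have "\<exists>Q. has_limit (S c) Q" for c
    unfolding S_def
  proof (rule has_limit_square)
    show "B + scaleC_op c A' \<in> H_infinity N P"
      by (intro H_add H_scale B H_adjoint[OF A A'])
    show "is_adjoint (B + scaleC_op c A') (B' + scaleC_op (cnj c) A)"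
      by (intro is_adjoint_add is_adjoint_scaleC B'(1) is_adjoint_sym[OF A'(1)])
    show "B' + scaleC_op (cnj c) A \<in> N"
      by (intro N_add N_scale B'(2) H_N[OF A])
  qed
  then obtain Q where Q: "has_limit (S c) (Q c)" for c
    by metis
  have clin: "blinfun_apply A (c *\<^sub>C x) = c *\<^sub>C blinfun_apply A x"
    "blinfun_apply B' (c *\<^sub>C x) = c *\<^sub>C blinfun_apply B' x" for c x
    using N_clinear A B'(2) by (auto simp: H_infinity_def bounded_clinear_ops_def)
  have "A o\<^sub>L B = scaleC_op (1 / 4)
      (S 1 + scaleC_op \<i> (S \<i>) + (scaleC_op (-1) (S (-1)) + scaleC_op (-\<i>) (S (-\<i>))))"
  proof (rule blinfun_eqI, rule cinner_eqI)
    fix x y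
    have S: "cinner (blinfun_apply (S c) x) y = cinner (blinfun_apply B' (blinfun_apply B x)) y
        + c * cinner (blinfun_apply B' (blinfun_apply A' x)) y
        + cnj c * cinner (blinfun_apply A (blinfun_apply B x)) y
        + cnj c * c * cinner (blinfun_apply A (blinfun_apply A' x)) y" for c
      by (simp add: S_def scaleC_op.rep_eq blinfun.add_left blinfun.add_right clin cinner_add_left
          cinner_scaleC_left distrib_left)
    show "cinner (blinfun_apply (A o\<^sub>L B) x) y = cinner (blinfun_apply (scaleC_op (1 / 4)
        (S 1 + scaleC_op \<i> (S \<i>) + (scaleC_op (-1) (S (-1)) + scaleC_op (-\<i>) (S (-\<i>))))) x) y"
      by (simp add: scaleC_op.rep_eq blinfun.add_left cinner_add_left cinner_scaleC_left S)
        (simp add: complex_eq_iff field_simps)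
  qed
  moreover have "has_limit (scaleC_op (1 / 4)
      (S 1 + scaleC_op \<i> (S \<i>) + (scaleC_op (-1) (S (-1)) + scaleC_op (-\<i>) (S (-\<i>)))))
      (scaleC_op (1 / 4)
      (Q 1 + scaleC_op \<i> (Q \<i>) + (scaleC_op (-1) (Q (-1)) + scaleC_op (-\<i>) (Q (-\<i>)))))"
    by (intro has_limit_add has_limit_scale Q)
  ultimately show ?thesis
    by metis
qed

end

section \<open>Cesaro means along a free ultrafilter\<close>

lemma cesaro_mean_null:
  fixes X :: "nat \<Rightarrow> 'a::real_normed_vector"
  assumes "X \<longlonglongrightarrow> 0"
  shows "(\<lambda>n. (1 / real n) *\<^sub>R (\<Sum>k<n. X k)) \<longlonglongrightarrow> 0"
proof (rule LIMSEQ_I)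
  fix e :: real
  assume "0 < e"
  then obtain K where K: "\<And>k. k \<ge> K \<Longrightarrow> norm (X k) < e / 2"
    using LIMSEQ_D[OF assms, of "e / 2"] by auto
  define C where "C = (\<Sum>k<K. norm (X k))"
  \<comment> \<open>The threshold makes the fixed head \<open>C\<close> smaller than
    \<open>n * e / 2\<close>; the tail has at most \<open>n\<close> terms, each below
    \<open>e / 2\<close>.\<close>
  have "norm ((1 / real n) *\<^sub>R (\<Sum>k<n. X k) - 0) < e" if "n \<ge> max (max K 1) (nat \<lceil>2 * C / e\<rceil> + 1)" for n
  proof -
    have n: "K \<le> n" "0 < n" and "2 * C / e < real n"
      using that by linarith+
    then have C: "C < real n * e / 2"
      using \<open>0 < e\<close> by (simp add: field_simps)
    have "norm (\<Sum>k<n. X k) \<le> (\<Sum>k<n. norm (X k))"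
      by (rule norm_sum)
    also have "\<dots> = C + (\<Sum>k=K..<n. norm (X k))"
      unfolding C_def using n by (simp add: lessThan_atLeast0 sum.atLeastLessThan_concat)
    also have "(\<Sum>k=K..<n. norm (X k)) \<le> real (card {K..<n}) * (e / 2)"
      using K by (intro sum_bounded_above) (auto intro: less_imp_le)
    also have "\<dots> \<le> real n * (e / 2)"
      using \<open>0 < e\<close> by (intro mult_right_mono) auto
    finally have "norm (\<Sum>k<n. X k) < real n * e"
      using C by simp
    then show ?thesis
      using n by (simp add: field_simps)
  qed
  then show "\<exists>n0. \<forall>n\<ge>n0. norm ((1 / real n) *\<^sub>R (\<Sum>k<n. X k) - 0) < e"
    by blast
qed

lemma cesaro_mean_tendsto:
  fixes X :: "nat \<Rightarrow> 'a::real_normed_vector"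
  assumes "X \<longlonglongrightarrow> l"
  shows "(\<lambda>n. (1 / real n) *\<^sub>R (\<Sum>k<n. X k)) \<longlonglongrightarrow> l"
proof (rule Lim_transform_eventually)
  show "(\<lambda>n. (1 / real n) *\<^sub>R (\<Sum>k<n. X k - l) + l) \<longlonglongrightarrow> l"
    using tendsto_add[OF cesaro_mean_null tendsto_const[of l]] assms by (simp add: LIM_zero_iff)
  \<comment> \<open>At \<open>n = 0\<close> the left side is \<open>l\<close> and the right side is
    0, so the identity is claimed only eventually.\<close>
  show "\<forall>\<^sub>F n in sequentially.
      (1 / real n) *\<^sub>R (\<Sum>k<n. X k - l) + l = (1 / real n) *\<^sub>R (\<Sum>k<n. X k)"
    using eventually_gt_at_top[of 0]
    by eventually_elim (simp add: sum_subtractf scaleR_diff_right sum_constant_scaleR)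
qed

text \<open>Each initial segment is a finite set of points, all avoided eventually. Ordinary limits
  are therefore limits along the ultrafilter.\<close>

lemma free_ultrafilter_le_sequentially:
  assumes "free_ultrafilter \<omega>"
  shows "\<omega> \<le> sequentially"
proof -
  have "eventually (\<lambda>n. N \<le> n) \<omega>" for N
  proof -
    have "eventually (\<lambda>n. \<forall>m\<in>{..<N}. n \<noteq> m) \<omega>"
      using assms by (intro eventually_ball_finite) (auto simp: free_ultrafilter_def)
    then show ?thesis
      by (rule eventually_mono) (use not_le in blast)
  qed
  then show ?thesis
    by (auto simp: le_sequentially)
qed

text \<open>The Cesaro means already converge strongly along all of \<open>sequentially\<close>. The
  definite description picks this value since weak limits along a proper filter are unique.\<close>

lemma cesaro_projection_eq:
  assumes "limitin strong_operator_topology (\<lambda>n. (P ^^ n) A) Q sequentially"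
    and "free_ultrafilter \<omega>"
  shows "cesaro_projection \<omega> P A = Q"
proof -
  have "limitin strong_operator_topology (\<lambda>n. (1 / real n) *\<^sub>R (\<Sum>k<n. (P ^^ k) A)) Q \<omega>"
    using assms(1) cesaro_mean_tendsto
    by (auto simp: limitin_strong_operator_topology blinfun.scaleR_left blinfun.sum_left
        intro!: tendsto_mono[OF free_ultrafilter_le_sequentially[OF assms(2)]])
  then have "limitin weak_operator_topology (\<lambda>n. (1 / real n) *\<^sub>R (\<Sum>k<n. (P ^^ k) A)) Q \<omega>"
    by (rule strong_imp_weak_limit)
  then show ?thesis
    unfolding cesaro_projection_def
    using limitin_weak_operator_topology_unique assms(2)
    by (intro the_equality) (auto simp: free_ultrafilter_def)
qed

theorem corollary5p2:
  fixes N :: "('h::complex_hilbert_space \<Rightarrow>\<^sub>L 'h) set"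
    and P :: "('h \<Rightarrow>\<^sub>L 'h) \<Rightarrow> ('h \<Rightarrow>\<^sub>L 'h)"
    and a b :: "'h \<Rightarrow>\<^sub>L 'h"
  assumes "von_neumann_algebra N"
    and "normal_ucp N P"
    and "a \<in> H_infinity N P" and "b \<in> H_infinity N P"
  shows "(\<forall>E. cp_projection_onto N (H_infinity N P) E \<longrightarrow>
            limitin strong_operator_topology (\<lambda>n. (P ^^ n) (a o\<^sub>L b))
              (choi_effros_product E a b) sequentially) \<and>
         (\<forall>\<omega>. free_ultrafilter \<omega> \<longrightarrow>
            limitin strong_operator_topology (\<lambda>n. (P ^^ n) (a o\<^sub>L b))
              (choi_effros_product (cesaro_projection \<omega> P) a b) sequentially)"
proof -
  interpret normal_ucp_map N P
    using assms(1,2) by unfold_locales (auto simp: normal_ucp_def)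
  obtain Q where "has_limit (a o\<^sub>L b) Q"
    using has_limit_mult[OF assms(3,4)] by blast
  then show ?thesis
    using cesaro_projection_eq[of P "a o\<^sub>L b" Q]
    unfolding has_limit_def choi_effros_product_def by metis
qed

end
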